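(* Let $n \geq 1$ be an integer. For every $u \in \mathbb{R}^n$, the function $f : \mathbb{R}^n \to \mathbb{R}$ defined by $$f(x) = \frac{1}{2}\sum_{i,j=1}^n |x_i x_j - u_i u_j|$$ has no spurious second-order stationary points; that is, every second-order stationary point of $f$ is a global minimum of $f$.
   Context: Subdifferential: $\partial f(x)$ denotes the (general, limiting) subdifferential of Rockafellar and Wets. A vector $v$ is a regular subgradient of $f$ at $x$ if $f(y) \geq f(x) + \langle v, y-x\rangle + o(|y-x|)$ as $y \to x$. Then $v \in \partial f(x)$ if there exist sequences $x^k \to x$ with $f(x^k)\to f(x)$ and $v^k \to v$ such that $v^k$ is a regular subgradient of $f$ at $x^k$ for every $k$. Second subderivative: for $x, v, w \in \mathbb{R}^n$, $$d^2 f(x|v)(w) := \liminf_{\tau \searrow 0,\; w' \to w} \frac{f(x+\tau w') - f(x) - \tau\langle v, w'\rangle}{\frac{1}{2}\tau^2},$$ with values in $[-\infty, +\infty]$. Second-order stationary point: a point $x \in \mathbb{R}^n$ such that $0 \in \partial f(x)$ and $d^2 f(x|0)(w) \geq 0$ for all $w \in \mathbb{R}^n$. Spurious means not a global minimum of $f$. *)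

theory Defs
  imports "HOL-Analysis.Analysis" "HOL-Library.Landau_Symbols"
begin

definition regular_subgradient :: "('a::euclidean_space \<Rightarrow> real) \<Rightarrow> 'a \<Rightarrow> 'a \<Rightarrow> bool" where
  "regular_subgradient f x v \<longleftrightarrow>
     (\<exists>r :: 'a \<Rightarrow> real. r \<in> o[at x](\<lambda>y. norm (y - x)) \<and>
        (\<forall>\<^sub>F y in at x. f y \<ge> f x + v \<bullet> (y - x) + r y))"

definition limiting_subdifferential :: "('a::euclidean_space \<Rightarrow> real) \<Rightarrow> 'a \<Rightarrow> 'a set" where
  "limiting_subdifferential f x =
     {v. \<exists>xs vs. xs \<longlonglongrightarrow> x \<and> (\<lambda>k. f (xs k)) \<longlonglongrightarrow> f x \<and> vs \<longlonglongrightarrow> v \<and>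
           (\<forall>k. regular_subgradient f (xs k) (vs k))}"

(* The limit w' \<rightarrow> w is taken along nhds w, not at w: the value w' = w is admitted. *)
definition second_subderivative ::
  "('a::euclidean_space \<Rightarrow> real) \<Rightarrow> 'a \<Rightarrow> 'a \<Rightarrow> 'a \<Rightarrow> ereal" where
  "second_subderivative f x v w =
     Liminf (at_right 0 \<times>\<^sub>F nhds w)
       (\<lambda>(\<tau>, w'). ereal ((f (x + \<tau> *\<^sub>R w') - f x - \<tau> * (v \<bullet> w')) / (1/2 * \<tau>\<^sup>2)))"

definition second_order_stationary :: "('a::euclidean_space \<Rightarrow> real) \<Rightarrow> 'a \<Rightarrow> bool" where
  "second_order_stationary f x \<longleftrightarrow>
     0 \<in> limiting_subdifferential f x \<and> (\<forall>w. second_subderivative f x 0 w \<ge> 0)"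

definition global_minimum :: "('a \<Rightarrow> real) \<Rightarrow> 'a \<Rightarrow> bool" where
  "global_minimum f x \<longleftrightarrow> (\<forall>y. f x \<le> f y)"

definition rank_one_l1_loss :: "real ^ 'n \<Rightarrow> real ^ 'n \<Rightarrow> real" where
  "rank_one_l1_loss u x =
     1/2 * (\<Sum>i\<in>UNIV. \<Sum>j\<in>UNIV. \<bar>x $ i * x $ j - u $ i * u $ j\<bar>)"

end

theory Submission
  imports Defs
begin

text \<open>
  At a second-order stationary point no line makes the loss decrease quadratically; in particular all
  one-sided directional derivatives are nonnegative. Shrinking the coordinates where \<open>u\<close> vanishes shows
  that \<open>x\<close> vanishes there too, so one may pass to the ratios \<open>r i = x i / u i\<close> and the loss
  \<open>1/2 * (\<Sum>i j. p i * p j * \<bar>r i * r j - 1\<bar>)\<close> with weights \<open>p i = \<bar>u i\<bar> > 0\<close>. First-order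
  conditions force \<open>\<bar>r i\<bar> \<le> 1\<close>. On that box the loss depends on \<open>r\<close> only through the square of
  \<open>\<Sum>i. p i * r i\<close>, that is, of the positive mass minus the negative mass. If both signs occur,
  the two masses must agree, and then shrinking the positive ratios alone decreases the loss to second
  order. So only one sign occurs, and raising any \<open>\<bar>r i\<bar> < 1\<close> would decrease the loss.
\<close>

section \<open>Second-order stationarity along lines\<close>

definition quadratic_descent :: "(real \<Rightarrow> real) \<Rightarrow> bool" where
  "quadratic_descent \<phi> \<longleftrightarrow> (\<exists>c>0. \<forall>\<^sub>F t in at_right 0. \<phi> t \<le> \<phi> 0 - c * t\<^sup>2)"

lemma second_order_stationary_no_descent:
  fixes f :: "'a::euclidean_space \<Rightarrow> real"
  assumes "second_order_stationary f x"
  shows "\<not> quadratic_descent (\<lambda>t. f (x + t *\<^sub>R w))"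
proof
  assume "quadratic_descent (\<lambda>t. f (x + t *\<^sub>R w))"
  then obtain c where c: "c > 0"
    and descent: "\<forall>\<^sub>F t in at_right 0. f (x + t *\<^sub>R w) \<le> f x - c * t\<^sup>2"
    unfolding quadratic_descent_def by auto
  have "ereal (- c) < 0" using c by simp
  also have "0 \<le> second_subderivative f x 0 w"
    using assms unfolding second_order_stationary_def by blast
  finally have "ereal (- c) < second_subderivative f x 0 w" .
  then have "\<forall>\<^sub>F z in at_right 0 \<times>\<^sub>F nhds w. ereal (- c) <
      (\<lambda>(\<tau>, w'). ereal ((f (x + \<tau> *\<^sub>R w') - f x - \<tau> * (0 \<bullet> w')) / (1/2 * \<tau>\<^sup>2))) z"
    unfolding second_subderivative_def by (rule less_LiminfD)
  then obtain P Q where P: "eventually P (at_right 0)" and Q: "eventually Q (nhds w)"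
    and PQ: "\<And>\<tau> w'. P \<tau> \<Longrightarrow> Q w' \<Longrightarrow> - c < (f (x + \<tau> *\<^sub>R w') - f x) / (1/2 * \<tau>\<^sup>2)"
    unfolding eventually_prod_filter by auto
  have "\<forall>\<^sub>F t::real in at_right 0. False"
    using P descent eventually_at_right_less[of 0]
  proof eventually_elim
    case (elim t)
    have "- c < (f (x + t *\<^sub>R w) - f x) / (1/2 * t\<^sup>2)"
      using PQ[OF elim(1) eventually_nhds_x_imp_x[OF Q]] .
    then have "- c * (1/2 * t\<^sup>2) < f (x + t *\<^sub>R w) - f x"
      using elim(3) by (subst (asm) pos_less_divide_eq) auto
    moreover have "0 < c * t\<^sup>2"
      using c elim(3) by simp
    ultimately show False
      using elim(2) by (simp add: field_simps)
  qed
  then show False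
    by (simp add: eventually_False trivial_limit_at_right_real)
qed

section \<open>One-sided slopes of sums of absolute values\<close>

text \<open>The one-sided derivative of the absolute value at \<open>c\<close> in the direction \<open>b\<close>.\<close>
definition dir_abs :: "real \<Rightarrow> real \<Rightarrow> real" where
  "dir_abs c b = (if c = 0 then \<bar>b\<bar> else sgn c * b)"

lemma dir_abs_simps:
  "c > 0 \<Longrightarrow> dir_abs c b = b"
  "c < 0 \<Longrightarrow> dir_abs c b = - b"
  "dir_abs 0 b = \<bar>b\<bar>"
  "dir_abs c 0 = 0"
  by (auto simp: dir_abs_def)

lemma dir_abs_minus: "dir_abs (- c) (- b) = dir_abs c b"
  by (auto simp: dir_abs_def sgn_minus)

lemma dir_abs_mult: "p > 0 \<Longrightarrow> dir_abs (p * c) (p * b) = p * dir_abs c b"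
  by (auto simp: dir_abs_def sgn_mult abs_mult)

lemma dir_abs_mult_right: "p > 0 \<Longrightarrow> dir_abs c (p * b) = p * dir_abs c b"
  by (auto simp: dir_abs_def abs_mult)

lemma dir_abs_neg_multiple: "dir_abs c (- (s * c)) = - (s * \<bar>c\<bar>)" if "s \<ge> 0"
  using that by (simp add: dir_abs_def abs_sgn)

text \<open>For \<open>c \<noteq> 0\<close> the quadratic keeps the sign of \<open>c\<close> near
  \<open>t = 0\<close>; for \<open>c = 0\<close> this is the triangle inequality.\<close>

lemma eventually_abs_quadratic_le:
  "\<forall>\<^sub>F t in at_right 0. \<bar>c + t * b + t\<^sup>2 * a\<bar> \<le> \<bar>c\<bar> + t * dir_abs c b + t\<^sup>2 * \<bar>a\<bar>"
proof -
  have pos: "\<forall>\<^sub>F t in at_right 0. \<bar>c + t * b + t\<^sup>2 * a\<bar> \<le> \<bar>c\<bar> + t * dir_abs c b + t\<^sup>2 * \<bar>a\<bar>"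
    if "c > 0" for a b c :: real
  proof -
    have "((\<lambda>t. c + t * b + t\<^sup>2 * a) \<longlongrightarrow> c + 0 * b + 0\<^sup>2 * a) (at_right 0)"
      by (intro tendsto_intros)
    then have "\<forall>\<^sub>F t in at_right 0. c + t * b + t\<^sup>2 * a > 0"
      by (rule order_tendstoD) (use that in simp)
    then show ?thesis
    proof eventually_elim
      case (elim t)
      have "t\<^sup>2 * a \<le> t\<^sup>2 * \<bar>a\<bar>" by (intro mult_left_mono) auto
      then show ?case using elim that by (simp add: dir_abs_simps)
    qed
  qed
  consider "c > 0" | "c < 0" | "c = 0" by linarith
  then show ?thesis
  proof cases
    case 1
    then show ?thesis by (rule pos)
  next
    case 2
    have *: "\<bar>- c + t * - b + t\<^sup>2 * - a\<bar> = \<bar>c + t * b + t\<^sup>2 * a\<bar>" for t by simp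
    from pos[of "- c" "- b" "- a", unfolded * dir_abs_minus] 2 show ?thesis by simp
  next
    case 3
    show ?thesis using eventually_at_right_less[of 0]
    proof eventually_elim
      case (elim t)
      have "\<bar>t * b + t\<^sup>2 * a\<bar> \<le> \<bar>t * b\<bar> + \<bar>t\<^sup>2 * a\<bar>" by simp
      then show ?case using elim 3 by (simp add: dir_abs_simps abs_mult)
    qed
  qed
qed

text \<open>A negative one-sided slope dominates the quadratic remainder, so excluding quadratic
  descent also yields first-order conditions.\<close>

lemma quadratic_descent_sum_abs:
  fixes a b c :: "'k \<Rightarrow> real"
  assumes "finite K" and neg: "(\<Sum>k\<in>K. dir_abs (c k) (b k)) < 0"
  shows "quadratic_descent (\<lambda>t. \<Sum>k\<in>K. \<bar>c k + t * b k + t\<^sup>2 * a k\<bar>)"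
proof -
  let ?D = "\<Sum>k\<in>K. dir_abs (c k) (b k)" and ?A = "\<Sum>k\<in>K. \<bar>a k\<bar>"
  have "\<forall>\<^sub>F t in at_right 0. \<forall>k\<in>K.
      \<bar>c k + t * b k + t\<^sup>2 * a k\<bar> \<le> \<bar>c k\<bar> + t * dir_abs (c k) (b k) + t\<^sup>2 * \<bar>a k\<bar>"
    using assms by (intro eventually_ball_finite ballI eventually_abs_quadratic_le)
  \<comment> \<open>Multiplied by \<open>t\<close>, this lets the slope absorb the remainder
    \<open>t\<^sup>2 * ?A\<close> and still leave a decrease of \<open>t\<^sup>2\<close>.\<close>
  moreover have "\<forall>\<^sub>F t in at_right 0. t * (?A + 1) < - ?D"
  proof -
    have "((\<lambda>t. t * (?A + 1)) \<longlongrightarrow> 0 * (?A + 1)) (at_right 0)"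
      by (intro tendsto_intros)
    then show ?thesis by (rule order_tendstoD) (use neg in simp)
  qed
  ultimately have "\<forall>\<^sub>F t in at_right 0.
      (\<Sum>k\<in>K. \<bar>c k + t * b k + t\<^sup>2 * a k\<bar>) \<le> (\<Sum>k\<in>K. \<bar>c k\<bar>) - 1 * t\<^sup>2"
    using eventually_at_right_less[of 0]
  proof eventually_elim
    case (elim t)
    have "(\<Sum>k\<in>K. \<bar>c k + t * b k + t\<^sup>2 * a k\<bar>)
        \<le> (\<Sum>k\<in>K. \<bar>c k\<bar> + t * dir_abs (c k) (b k) + t\<^sup>2 * \<bar>a k\<bar>)"
      using elim(1) by (intro sum_mono) auto
    also have "\<dots> = (\<Sum>k\<in>K. \<bar>c k\<bar>) + t * ?D + t\<^sup>2 * ?A"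
      by (simp add: sum.distrib sum_distrib_left)
    also have "\<dots> \<le> (\<Sum>k\<in>K. \<bar>c k\<bar>) - 1 * t\<^sup>2"
    proof -
      have "t * (t * (?A + 1)) \<le> t * (- ?D)"
        using elim(2,3) by (intro mult_left_mono) auto
      then show ?thesis by (simp add: power2_eq_square algebra_simps)
    qed
    finally show ?case .
  qed
  then show ?thesis
    unfolding quadratic_descent_def by (intro exI[of _ 1]) simp
qed

section \<open>The weighted problem in the ratios\<close>

definition ratio_loss :: "'i set \<Rightarrow> ('i \<Rightarrow> real) \<Rightarrow> ('i \<Rightarrow> real) \<Rightarrow> real" where
  "ratio_loss I p r = (\<Sum>i\<in>I. \<Sum>j\<in>I. p i * p j * \<bar>r i * r j - 1\<bar>)"

text \<open>Stationarity is kept only as the absence of quadratic descent along lines, a condition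
  stable under the sign change of \<open>r\<close> exploited below.\<close>

locale stationary_ratios =
  fixes I :: "'i set" and p r :: "'i \<Rightarrow> real"
  assumes finite: "finite I"
    and weight_pos: "i \<in> I \<Longrightarrow> p i > 0"
    and no_descent: "\<not> quadratic_descent (\<lambda>t. ratio_loss I p (\<lambda>i. r i + t * v i))"
begin

text \<open>The double sum is the one-sided derivative of the loss along \<open>v\<close>: each
  product of moved ratios is an exact quadratic in \<open>t\<close> with linear coefficient
  \<open>r i * v j + r j * v i\<close>.\<close>

lemma first_order:
  "0 \<le> (\<Sum>i\<in>I. \<Sum>j\<in>I. p i * p j * dir_abs (r i * r j - 1) (r i * v j + r j * v i))"
proof (rule ccontr)
  let ?c = "\<lambda>(i, j). p i * p j * (r i * r j - 1)"
  let ?b = "\<lambda>(i, j). p i * p j * (r i * v j + r j * v i)"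
  let ?a = "\<lambda>(i, j). p i * p j * (v i * v j)"
  assume "\<not> ?thesis"
  moreover have "(\<Sum>k\<in>I \<times> I. dir_abs (?c k) (?b k)) =
      (\<Sum>i\<in>I. \<Sum>j\<in>I. p i * p j * dir_abs (r i * r j - 1) (r i * v j + r j * v i))"
    unfolding sum.cartesian_product
    by (intro sum.cong refl) (auto intro!: dir_abs_mult mult_pos_pos weight_pos)
  ultimately have "(\<Sum>k\<in>I \<times> I. dir_abs (?c k) (?b k)) < 0" by simp
  then have "quadratic_descent (\<lambda>t. \<Sum>k\<in>I \<times> I. \<bar>?c k + t * ?b k + t\<^sup>2 * ?a k\<bar>)"
    using finite by (intro quadratic_descent_sum_abs) auto
  moreover have "(\<Sum>k\<in>I \<times> I. \<bar>?c k + t * ?b k + t\<^sup>2 * ?a k\<bar>)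
      = ratio_loss I p (\<lambda>i. r i + t * v i)" for t
    unfolding ratio_loss_def sum.cartesian_product
  proof (intro sum.cong refl, clarify)
    fix i j assume "i \<in> I" "j \<in> I"
    then have p: "p i * p j > 0" by (simp add: weight_pos)
    have "p i * p j * (r i * r j - 1) + t * (p i * p j * (r i * v j + r j * v i))
        + t\<^sup>2 * (p i * p j * (v i * v j))
        = p i * p j * ((r i + t * v i) * (r j + t * v j) - 1)"
      by (simp add: power2_eq_square algebra_simps)
    then show "\<bar>p i * p j * (r i * r j - 1) + t * (p i * p j * (r i * v j + r j * v i))
        + t\<^sup>2 * (p i * p j * (v i * v j))\<bar>
        = p i * p j * \<bar>(r i + t * v i) * (r j + t * v j) - 1\<bar>"
      using p by (metis abs_mult abs_of_pos)
  qed
  ultimately show False using no_descent[of v] by simp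
qed

text \<open>Only \<open>r k\<close> moves, with speed \<open>s\<close>. Pairs \<open>(k, j)\<close>
  and \<open>(j, k)\<close> contribute alike, so the full derivative is \<open>2 * p k\<close> times
  this sum.\<close>

lemma partial_derivative_nonneg:
  assumes k: "k \<in> I"
  shows "0 \<le> (\<Sum>j\<in>I. p j * dir_abs (r k * r j - 1) (s * r j))"
proof -
  let ?d = "\<lambda>j. p j * dir_abs (r k * r j - 1) (s * r j)"
  let ?e = "\<lambda>i. if i = k then 1 else 0 :: real"
  let ?v = "\<lambda>i. if i = k then s else 0"
  have "0 \<le> (\<Sum>i\<in>I. \<Sum>j\<in>I. p i * p j * dir_abs (r i * r j - 1) (r i * ?v j + r j * ?v i))"
    by (rule first_order)
  also have "\<dots> = (\<Sum>i\<in>I. \<Sum>j\<in>I. p k * (?e i * ?d j + ?e j * ?d i))"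
  proof (intro sum.cong refl)
    fix i j
    \<comment> \<open>On the diagonal pair the factor 2 from differentiating a square matches
      \<open>?e i + ?e j = 2\<close>.\<close>
    have "dir_abs (r k * r k - 1) (2 * (r k * s)) = 2 * dir_abs (r k * r k - 1) (r k * s)"
      by (rule dir_abs_mult_right) simp
    then show "p i * p j * dir_abs (r i * r j - 1) (r i * ?v j + r j * ?v i)
        = p k * (?e i * ?d j + ?e j * ?d i)"
      by (auto simp: dir_abs_simps mult.commute)
  qed
  also have "\<dots> = 2 * p k * (\<Sum>j\<in>I. ?d j)"
  proof -
    have e: "(\<Sum>i\<in>I. ?e i) = 1" using k finite by simp
    have "(\<Sum>i\<in>I. \<Sum>j\<in>I. p k * (?e i * ?d j + ?e j * ?d i))
        = p k * ((\<Sum>i\<in>I. ?e i) * (\<Sum>j\<in>I. ?d j) + (\<Sum>j\<in>I. ?e j) * (\<Sum>i\<in>I. ?d i))"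
      by (simp add: sum.distrib flip: sum_distrib_left sum_distrib_right)
    then show ?thesis unfolding e by simp
  qed
  finally show ?thesis
    using weight_pos[OF k] by (simp add: zero_le_mult_iff)
qed

section \<open>Comparing positive and negative mass\<close>

definition pos_mass :: real where "pos_mass = (\<Sum>i\<in>I. if r i > 0 then p i * r i else 0)"
definition neg_mass :: real where "neg_mass = (\<Sum>i\<in>I. if r i < 0 then - (p i * r i) else 0)"

lemma neg_mass_nonneg: "neg_mass \<ge> 0"
  unfolding neg_mass_def by (intro sum_nonneg) (auto simp: mult_le_0_iff dest: weight_pos)

lemma pos_mass_pos:
  assumes "k \<in> I" "r k > 0" shows "pos_mass > 0"
  unfolding pos_mass_def
  by (rule sum_pos2[OF finite assms(1)]) (use assms in \<open>auto dest: weight_pos\<close>)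

text \<open>When \<open>r k\<close> is raised, all products \<open>r k * r j\<close> lie below 1, so
  each term has slope \<open>- (p j * r j)\<close>; these add up to
  \<open>neg_mass - pos_mass\<close>.\<close>

lemma pos_mass_le_neg_mass:
  assumes k: "k \<in> I" "r k \<ge> 0" and lt: "\<And>j. j \<in> I \<Longrightarrow> r j > 0 \<Longrightarrow> r k * r j < 1"
  shows "pos_mass \<le> neg_mass"
proof -
  have "0 \<le> (\<Sum>j\<in>I. p j * dir_abs (r k * r j - 1) (1 * r j))"
    by (rule partial_derivative_nonneg[OF k(1)])
  also have "\<dots> = (\<Sum>j\<in>I. (if r j < 0 then - (p j * r j) else 0) - (if r j > 0 then p j * r j else 0))"
  proof (intro sum.cong refl)
    fix j assume j: "j \<in> I"
    have "r k * r j < 1"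
      using lt[OF j] k(2) mult_nonneg_nonpos[of "r k" "r j"] by (cases "r j > 0") auto
    then show "p j * dir_abs (r k * r j - 1) (1 * r j)
        = (if r j < 0 then - (p j * r j) else 0) - (if r j > 0 then p j * r j else 0)"
      by (auto simp: dir_abs_simps)
  qed
  also have "\<dots> = neg_mass - pos_mass"
    unfolding sum_subtractf pos_mass_def neg_mass_def ..
  finally show ?thesis by simp
qed

text \<open>Here \<open>r k\<close> is lowered. Products equal to 1 are allowed: leaving the kink
  costs \<open>\<bar>r j\<bar> = r j\<close>, the same slope as for a product below 1.\<close>

lemma neg_mass_le_pos_mass:
  assumes k: "k \<in> I" "r k > 0" and le: "\<And>j. j \<in> I \<Longrightarrow> r k * r j \<le> 1"
  shows "neg_mass \<le> pos_mass"
proof -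
  have "0 \<le> (\<Sum>j\<in>I. p j * dir_abs (r k * r j - 1) ((-1) * r j))"
    by (rule partial_derivative_nonneg[OF k(1)])
  also have "\<dots> = (\<Sum>j\<in>I. (if r j > 0 then p j * r j else 0) - (if r j < 0 then - (p j * r j) else 0))"
  proof (intro sum.cong refl)
    fix j assume j: "j \<in> I"
    have "r k * r j < 1 \<or> r k * r j = 1 \<and> r j > 0"
      using le[OF j] k(2) mult_nonneg_nonpos[of "r k" "r j"] by (cases "r j > 0") auto
    then show "p j * dir_abs (r k * r j - 1) ((-1) * r j)
        = (if r j > 0 then p j * r j else 0) - (if r j < 0 then - (p j * r j) else 0)"
      by (auto simp: dir_abs_simps)
  qed
  also have "\<dots> = pos_mass - neg_mass"
    unfolding sum_subtractf pos_mass_def neg_mass_def ..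
  finally show ?thesis by simp
qed

section \<open>Ratios do not exceed one\<close>

lemma ratio_le_one:
  assumes "i \<in> I" shows "r i \<le> 1"
proof (rule ccontr)
  assume "\<not> r i \<le> 1"
  define M where "M = Max (r ` I)"
  have "M \<in> r ` I" unfolding M_def using assms finite by (intro Max_in) auto
  then obtain k where k: "k \<in> I" "r k = M" by auto
  have le_M: "r j \<le> M" if "j \<in> I" for j unfolding M_def using that finite by simp
  have M: "M > 1" using le_M[OF assms] \<open>\<not> r i \<le> 1\<close> by simp
  \<comment> \<open>\<open>\<alpha>\<close> collects the mass at the maximum \<open>M\<close>,
    \<open>\<beta>\<close> the mass at \<open>1 / M\<close>, where the product with \<open>M\<close>
    sits at the kink, and \<open>\<nu>\<close> the negative mass.\<close>
  define \<alpha> where "\<alpha> j = (if r j = M then p j * r j else 0)" for j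
  define \<beta> where "\<beta> j = (if M * r j = 1 then p j * r j else 0)" for j
  define \<nu> where "\<nu> j = (if r j < 0 then - (p j * r j) else 0)" for j
  have S\<nu>: "sum \<nu> I = neg_mass" unfolding \<nu>_def neg_mass_def ..
  have S\<alpha>: "sum \<alpha> I > 0"
    by (rule sum_pos2[OF finite k(1)]) (use k M in \<open>auto simp: \<alpha>_def dest: weight_pos\<close>)
  have lower: "0 \<le> (\<Sum>j\<in>I. p j * dir_abs (r k * r j - 1) ((-1) * r j))"
    by (rule partial_derivative_nonneg[OF k(1)])
  have sign: "M * r j < 1" if "r j \<le> 0" for j
    using mult_nonneg_nonpos[of M "r j"] that M by simp
  \<comment> \<open>Lowering a maximal ratio bounds the negative mass from above. If some positive ratio is below
    \<open>1 / M\<close>, raising it gives a contradictory bound from below; otherwise lowering all ratios equal to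
    \<open>M\<close> and raising all those equal to \<open>1 / M\<close> by the same factor, which keeps their products
    equal to 1, decreases the loss.\<close>
  show False
  proof (cases "\<exists>l\<in>I. r l > 0 \<and> M * r l < 1")
    case True
    then obtain l where l: "l \<in> I" "r l > 0" "M * r l < 1" by auto
    have "pos_mass \<le> neg_mass"
    proof (rule pos_mass_le_neg_mass)
      fix j assume "j \<in> I" "r j > 0"
      then have "r j * r l \<le> M * r l" using le_M l by (intro mult_right_mono) auto
      then have "r j * r l < 1" using l by linarith
      then show "r l * r j < 1" by (simp add: mult.commute)
    qed (use l in auto)
    also have "neg_mass < pos_mass"
    proof -
      note lower
      also have "(\<Sum>j\<in>I. p j * dir_abs (r k * r j - 1) ((-1) * r j))
          \<le> (\<Sum>j\<in>I. (if r j > 0 then p j * r j else 0) - \<nu> j - \<alpha> j)"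
      \<comment> \<open>Positive ratios have slope at most \<open>p j * r j\<close>. Those equal to
        \<open>M\<close> have product \<open>M * M > 1\<close> with \<open>r k\<close>, hence
        negative slope; bounding it by 0 frees the slack \<open>\<alpha> j\<close> that makes the
        inequality strict.\<close>
      proof (rule sum_mono)
        fix j assume j: "j \<in> I"
        note w = weight_pos[OF j]
        have MM: "M * M > 1" using M by (simp add: less_1_mult)
        consider "r j \<le> 0" | "r j > 0" "M * r j < 1" | "r j > 0" "M * r j = 1" | "r j > 0" "M * r j > 1"
          by linarith
        then show "p j * dir_abs (r k * r j - 1) ((-1) * r j)
            \<le> (if r j > 0 then p j * r j else 0) - \<nu> j - \<alpha> j"
          by cases (use w M MM k sign[of j] in \<open>auto simp: dir_abs_simps \<nu>_def \<alpha>_def\<close>)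
      qed
      also have "\<dots> = pos_mass - neg_mass - sum \<alpha> I"
        unfolding sum_subtractf S\<nu> pos_mass_def ..
      finally show ?thesis using S\<alpha> by simp
    qed
    finally show False by simp
  next
    case False
    then have ge: "M * r j \<ge> 1" if "j \<in> I" "r j > 0" for j using that by force
    \<comment> \<open>No positive ratio is below \<open>1 / M\<close>. Those at \<open>1 / M\<close>
      contribute \<open>\<beta>\<close>; of the larger ones, whose slopes are negative, only the
      maximal ones are kept, contributing \<open>- \<alpha>\<close>.\<close>
    have S\<beta>: "neg_mass \<le> sum \<beta> I - sum \<alpha> I"
    proof -
      note lower
      also have "(\<Sum>j\<in>I. p j * dir_abs (r k * r j - 1) ((-1) * r j)) \<le> (\<Sum>j\<in>I. \<beta> j - \<alpha> j - \<nu> j)"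
      proof (rule sum_mono)
        fix j assume j: "j \<in> I"
        note w = weight_pos[OF j]
        have MM: "M * M > 1" using M by (simp add: less_1_mult)
        consider "r j \<le> 0" | "r j > 0" "M * r j = 1" | "r j > 0" "M * r j > 1"
          using ge[OF j] by linarith
        then show "p j * dir_abs (r k * r j - 1) ((-1) * r j) \<le> \<beta> j - \<alpha> j - \<nu> j"
          by cases (use w M MM k sign[of j] in \<open>auto simp: dir_abs_simps \<nu>_def \<alpha>_def \<beta>_def\<close>)
      qed
      also have "\<dots> = sum \<beta> I - sum \<alpha> I - neg_mass"
        unfolding sum_subtractf S\<nu> ..
      finally show ?thesis by simp
    qed
    define v where "v j = (if r j = M then - r j else if M * r j = 1 then r j else 0)" for j
    have "0 \<le> (\<Sum>i\<in>I. \<Sum>j\<in>I. p i * p j * dir_abs (r i * r j - 1) (r i * v j + r j * v i))"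
      by (rule first_order)
    \<comment> \<open>Pairs of a nonpositive and a positive ratio are computed exactly. Pairs at
      \<open>M\<close> and pairs at \<open>1 / M\<close> each gain at relative rate 2, mixed
      \<open>M\<close>, \<open>1 / M\<close> pairs are neutral to first order, and other gains are
      dropped.\<close>
    also have "\<dots> \<le> (\<Sum>i\<in>I. \<Sum>j\<in>I. \<nu> i * (\<beta> j - \<alpha> j) + (\<beta> i - \<alpha> i) * \<nu> j
        - 2 * (\<alpha> i * \<alpha> j) - 2 * (\<beta> i * \<beta> j))"
    proof (intro sum_mono)
      fix i j assume ij: "i \<in> I" "j \<in> I"
      have w: "p i * p j > 0" using ij by (simp add: weight_pos)
      have zero: "v a = 0" "\<alpha> a = 0" "\<beta> a = 0" if "r a \<le> 0" for a
        using that M sign[of a] by (auto simp: v_def \<alpha>_def \<beta>_def)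
      have \<nu>0: "\<nu> a = 0" if "r a > 0" for a
        using that by (simp add: \<nu>_def)
      have v: "p a * v a = \<beta> a - \<alpha> a" for a
        using M less_1_mult[OF M M] by (auto simp: v_def \<alpha>_def \<beta>_def)
      have mixed: "p a * p b * dir_abs (r a * r b - 1) (r a * v b) = \<nu> a * (\<beta> b - \<alpha> b)"
        if "r a \<le> 0" "r b > 0" for a b
      proof -
        have "r a * r b \<le> 0" using that by (simp add: mult_nonpos_nonneg)
        then have "dir_abs (r a * r b - 1) (r a * v b) = - (r a * v b)"
          by (simp add: dir_abs_simps)
        moreover have "\<nu> a = - (p a * r a)" using that by (auto simp: \<nu>_def)
        ultimately show ?thesis unfolding v[symmetric] by (simp add: algebra_simps)
      qed
      consider "r i \<le> 0" "r j \<le> 0" | "r i \<le> 0" "r j > 0" | "r i > 0" "r j \<le> 0" | "r i > 0" "r j > 0"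
        by linarith
      then show "p i * p j * dir_abs (r i * r j - 1) (r i * v j + r j * v i)
          \<le> \<nu> i * (\<beta> j - \<alpha> j) + (\<beta> i - \<alpha> i) * \<nu> j - 2 * (\<alpha> i * \<alpha> j) - 2 * (\<beta> i * \<beta> j)"
      proof cases
        case 1
        then show ?thesis by (simp add: zero dir_abs_simps)
      next
        case 2
        then show ?thesis using mixed[OF 2] by (simp add: zero \<nu>0)
      next
        case 3
        then show ?thesis using mixed[OF 3(2,1)] by (simp add: zero \<nu>0 mult.commute)
      next
        case 4
        \<comment> \<open>\<open>e a\<close> is the relative speed \<open>v a / r a\<close>. A
          nonzero \<open>e i + e j\<close> always pushes the product \<open>r i * r j\<close>
          towards 1.\<close>
        define e where "e a = (if r a = M then - 1 else if M * r a = 1 then 1 else 0 :: real)" for a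
        have MM: "M * M > 1" using M by (simp add: less_1_mult)
        have lessM: "r a * r b < 1" if "M * r a = 1" "r a > 0" "b \<in> I" "r b \<noteq> M" for a b
          using mult_strict_left_mono[of "r b" M "r a"] le_M[OF that(3)] that
          by (simp add: mult.commute)
        have gt: "M * r a > 1" if "a \<in> I" "r a > 0" "M * r a \<noteq> 1" for a
          using ge[OF that(1,2)] that(3) by simp
        have dir: "dir_abs (r i * r j - 1) (r i * r j * (e i + e j)) = - (r i * r j * \<bar>e i + e j\<bar>)"
        proof -
          have "e i + e j = 0 \<or> e i + e j < 0 \<and> r i * r j > 1 \<or> e i + e j > 0 \<and> r i * r j < 1"
          proof (cases "r i = M")
            case True
            then show ?thesis using gt[OF ij(2) 4(2)] MM by (auto simp: e_def)
          next
            case i: False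
            show ?thesis
            proof (cases "r j = M")
              case True
              then show ?thesis
                using i gt[OF ij(1) 4(1)] MM by (auto simp: e_def mult.commute[of M "r i"])
            next
              case False
              then show ?thesis
                using i lessM[OF _ 4(1) ij(2)] lessM[OF _ 4(2) ij(1)]
                by (simp add: e_def mult.commute[of "r j" "r i"])
            qed
          qed
          then consider "e i + e j = 0" | "e i + e j < 0" "r i * r j > 1" | "e i + e j > 0" "r i * r j < 1"
            by blast
          then show ?thesis by cases (auto simp: dir_abs_simps algebra_simps)
        qed
        have "r i * v j + r j * v i = r i * r j * (e i + e j)"
          by (auto simp: v_def e_def algebra_simps)
        then have "p i * p j * dir_abs (r i * r j - 1) (r i * v j + r j * v i)
            = - ((p i * r i) * (p j * r j) * \<bar>e i + e j\<bar>)"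
          using dir by simp
        also have "\<dots> \<le> - 2 * (\<alpha> i * \<alpha> j) - 2 * (\<beta> i * \<beta> j)"
          using MM 4 weight_pos[OF ij(1)] weight_pos[OF ij(2)]
          by (auto simp: e_def \<alpha>_def \<beta>_def)
        finally show ?thesis using 4 by (simp add: \<nu>0)
      qed
    qed
    also have "\<dots> = 2 * (neg_mass * (sum \<beta> I - sum \<alpha> I)) - 2 * (sum \<alpha> I)\<^sup>2 - 2 * (sum \<beta> I)\<^sup>2"
    proof -
      have "(\<Sum>i\<in>I. \<Sum>j\<in>I. \<nu> i * (\<beta> j - \<alpha> j) + (\<beta> i - \<alpha> i) * \<nu> j
          - 2 * (\<alpha> i * \<alpha> j) - 2 * (\<beta> i * \<beta> j))
        = sum \<nu> I * (\<Sum>j\<in>I. \<beta> j - \<alpha> j) + (\<Sum>j\<in>I. \<beta> j - \<alpha> j) * sum \<nu> I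
          - 2 * (sum \<alpha> I * sum \<alpha> I) - 2 * (sum \<beta> I * sum \<beta> I)"
        by (simp add: sum.distrib sum_subtractf flip: sum_distrib_left sum_distrib_right)
      then show ?thesis
        by (simp add: S\<nu> sum_subtractf power2_eq_square)
    qed
    \<comment> \<open>Since \<open>sum \<beta> I - sum \<alpha> I\<close> bounds the nonnegative
      \<open>neg_mass\<close>, it is itself nonnegative and may replace it. It also gives
      \<open>sum \<beta> I > 0\<close> for the final strict inequality.\<close>
    also have "\<dots> \<le> 2 * (sum \<beta> I - sum \<alpha> I)\<^sup>2 - 2 * (sum \<alpha> I)\<^sup>2 - 2 * (sum \<beta> I)\<^sup>2"
      using mult_right_mono[OF S\<beta>, of "sum \<beta> I - sum \<alpha> I"] S\<beta> neg_mass_nonneg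
      by (simp add: power2_eq_square)
    also have "\<dots> = - 4 * (sum \<alpha> I * sum \<beta> I)"
      by (simp add: power2_eq_square algebra_simps)
    also have "\<dots> < 0"
      using S\<alpha> S\<beta> neg_mass_nonneg by simp
    finally show False by simp
  qed
qed

section \<open>Sign symmetry and the possible ratios\<close>

text \<open>The loss sees only products of ratios. Negation turns upper bounds into lower bounds and
  exchanges the two masses.\<close>

lemma stationary_ratios_uminus: "stationary_ratios I p (\<lambda>i. - r i)"
proof
  fix v
  have "ratio_loss I p (\<lambda>i. - r i + t * v i) = ratio_loss I p (\<lambda>i. r i + t * - v i)" for t
    unfolding ratio_loss_def by (intro sum.cong refl) (simp add: algebra_simps)
  then show "\<not> quadratic_descent (\<lambda>t. ratio_loss I p (\<lambda>i. - r i + t * v i))"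
    using no_descent[of "\<lambda>i. - v i"] by simp
qed (simp_all add: finite weight_pos)

text \<open>On the box each term is \<open>1 - r i * r j\<close>, so the loss is a constant minus
  \<open>(pos_mass - neg_mass)\<^sup>2\<close>. With equal masses, scaling the positive ratios by
  \<open>1 - t\<close> makes this square \<open>pos_mass\<^sup>2 * t\<^sup>2\<close>.\<close>

lemma pos_mass_ne_neg_mass:
  assumes k: "k \<in> I" "r k > 0" and abs_le: "\<And>j. j \<in> I \<Longrightarrow> \<bar>r j\<bar> \<le> 1"
  shows "pos_mass \<noteq> neg_mass"
proof
  assume eq: "pos_mass = neg_mass"
  define \<pi> where "\<pi> j = (if r j > 0 then p j * r j else 0)" for j
  define \<nu> where "\<nu> j = (if r j < 0 then - (p j * r j) else 0)" for j
  define v where "v j = (if r j > 0 then - r j else 0)" for j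
  have diff: "ratio_loss I p (\<lambda>i. r i + t * v i) = ratio_loss I p r - pos_mass\<^sup>2 * t\<^sup>2"
    if t: "0 < t" "t < 1" for t
  proof -
    \<comment> \<open>The coefficient \<open>2 * t - t\<^sup>2\<close> is
      \<open>1 - (1 - t)\<^sup>2\<close>, from pairs with both factors scaled; pairs of opposite
      sign have one scaled factor. Equal masses cancel the linear terms.\<close>
    have "ratio_loss I p (\<lambda>i. r i + t * v i) =
       (\<Sum>i\<in>I. \<Sum>j\<in>I. p i * p j * \<bar>r i * r j - 1\<bar> + (2 * t - t\<^sup>2) * (\<pi> i * \<pi> j)
         - t * (\<pi> i * \<nu> j) - t * (\<nu> i * \<pi> j))"
      unfolding ratio_loss_def
    proof (intro sum.cong refl)
      fix i j assume ij: "i \<in> I" "j \<in> I"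
      have le: "\<bar>x * y\<bar> \<le> 1" if "\<bar>x\<bar> \<le> 1" "\<bar>y\<bar> \<le> 1" for x y :: real
        using that by (simp add: abs_mult mult_le_one)
      have v: "\<bar>r a + t * v a\<bar> \<le> 1" if "a \<in> I" for a
      proof -
        have "r a + t * v a = r a * (if r a > 0 then 1 - t else 1)"
          by (simp add: v_def algebra_simps)
        also have "\<bar>\<dots>\<bar> \<le> 1"
          by (rule le) (use abs_le[OF that] t in auto)
        finally show ?thesis .
      qed
      have "\<bar>(r i + t * v i) * (r j + t * v j) - 1\<bar> = 1 - (r i + t * v i) * (r j + t * v j)"
        using le[OF v[OF ij(1)] v[OF ij(2)]] by linarith
      moreover have "\<bar>r i * r j - 1\<bar> = 1 - r i * r j"
        using le[OF abs_le[OF ij(1)] abs_le[OF ij(2)]] by linarith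
      ultimately show "p i * p j * \<bar>(r i + t * v i) * (r j + t * v j) - 1\<bar>
          = p i * p j * \<bar>r i * r j - 1\<bar> + (2 * t - t\<^sup>2) * (\<pi> i * \<pi> j)
            - t * (\<pi> i * \<nu> j) - t * (\<nu> i * \<pi> j)"
        by (auto simp: v_def \<pi>_def \<nu>_def power2_eq_square algebra_simps)
    qed
    also have "\<dots> = ratio_loss I p r + (2 * t - t\<^sup>2) * (sum \<pi> I * sum \<pi> I)
        - t * (sum \<pi> I * sum \<nu> I) - t * (sum \<nu> I * sum \<pi> I)"
      unfolding ratio_loss_def
      by (simp add: sum.distrib sum_subtractf flip: sum_distrib_left sum_distrib_right)
    also have "sum \<pi> I = pos_mass" unfolding \<pi>_def pos_mass_def ..
    also have "sum \<nu> I = pos_mass" unfolding eq \<nu>_def neg_mass_def ..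
    finally show ?thesis by (simp add: power2_eq_square algebra_simps)
  qed
  have "\<forall>\<^sub>F t::real in at_right 0. 0 < t \<and> t < 1"
    using eventually_at_right_real[of 0 1] by simp
  then have "quadratic_descent (\<lambda>t. ratio_loss I p (\<lambda>i. r i + t * v i))"
    unfolding quadratic_descent_def using pos_mass_pos[OF k]
    by (intro exI[of _ "pos_mass\<^sup>2"]) (auto elim!: eventually_mono simp: diff)
  then show False using no_descent by simp
qed

text \<open>At the origin the slopes vanish, but raising all ratios to \<open>t\<close> turns every
  term into \<open>1 - t\<^sup>2\<close>, a second-order decrease.\<close>

lemma ex_ratio_nonzero:
  assumes "I \<noteq> {}" shows "\<exists>k\<in>I. r k \<noteq> 0"
proof (rule ccontr)
  assume "\<not> ?thesis"
  then have r0: "r i = 0" if "i \<in> I" for i using that by simp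
  have diff: "ratio_loss I p (\<lambda>i. r i + t * 1) = ratio_loss I p r - (sum p I)\<^sup>2 * t\<^sup>2"
    if t: "0 < t" "t < 1" for t
  proof -
    have "ratio_loss I p (\<lambda>i. r i + t * 1) = (\<Sum>i\<in>I. \<Sum>j\<in>I. p i * p j * \<bar>r i * r j - 1\<bar> - t\<^sup>2 * (p i * p j))"
      unfolding ratio_loss_def
    proof (intro sum.cong refl)
      fix i j assume ij: "i \<in> I" "j \<in> I"
      have "t * t \<le> 1" using t by (intro mult_le_one) auto
      then show "p i * p j * \<bar>(r i + t * 1) * (r j + t * 1) - 1\<bar>
          = p i * p j * \<bar>r i * r j - 1\<bar> - t\<^sup>2 * (p i * p j)"
        using ij by (simp add: r0 power2_eq_square algebra_simps)
    qed
    also have "\<dots> = ratio_loss I p r - t\<^sup>2 * (sum p I * sum p I)"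
      unfolding ratio_loss_def
      by (simp add: sum.distrib sum_subtractf flip: sum_distrib_left sum_distrib_right)
    finally show ?thesis by (simp add: power2_eq_square algebra_simps)
  qed
  have "sum p I > 0"
    using assms finite weight_pos by (intro sum_pos) auto
  moreover have "\<forall>\<^sub>F t::real in at_right 0. 0 < t \<and> t < 1"
    using eventually_at_right_real[of 0 1] by simp
  ultimately have "quadratic_descent (\<lambda>t. ratio_loss I p (\<lambda>i. r i + t * 1))"
    unfolding quadratic_descent_def
    by (intro exI[of _ "(sum p I)\<^sup>2"]) (auto elim!: eventually_mono simp: diff[simplified])
  then show False using no_descent[of "\<lambda>_. 1"] by simp
qed

text \<open>Lowering \<open>r k\<close> and the second-order argument give
  \<open>neg_mass < pos_mass\<close>. A negative ratio would reverse this by symmetry, and so would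
  raising a ratio in \<open>[0, 1)\<close>.\<close>

lemma all_ratios_one:
  assumes k: "k \<in> I" "r k > 0" and i: "i \<in> I"
  shows "r i = 1"
proof -
  interpret neg: stationary_ratios I p "\<lambda>i. - r i"
    by (rule stationary_ratios_uminus)
  have swap: "neg.pos_mass = neg_mass" "neg.neg_mass = pos_mass"
    unfolding neg.pos_mass_def neg.neg_mass_def pos_mass_def neg_mass_def
    by (auto intro!: sum.cong)
  have abs_le: "\<bar>r j\<bar> \<le> 1" if "j \<in> I" for j
    using ratio_le_one[OF that] neg.ratio_le_one[OF that] by linarith
  have prod_le: "r a * r b \<le> 1" if "a \<in> I" "b \<in> I" for a b
    using mult_le_one[of "\<bar>r a\<bar>" "\<bar>r b\<bar>"] abs_le[OF that(1)] abs_le[OF that(2)]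
    by (simp flip: abs_mult)
  have "neg_mass \<le> pos_mass"
    using k prod_le by (intro neg_mass_le_pos_mass) auto
  then have less: "neg_mass < pos_mass"
    using pos_mass_ne_neg_mass[OF k abs_le] by simp
  have nonneg: "r j \<ge> 0" if "j \<in> I" for j
    using neg.neg_mass_le_pos_mass[OF that] prod_le[OF that] less unfolding swap by force
  show ?thesis
  proof (rule ccontr)
    assume "r i \<noteq> 1"
    then have ri: "0 \<le> r i" "r i < 1" using nonneg[OF i] abs_le[OF i] by auto
    have "pos_mass \<le> neg_mass"
    proof (rule pos_mass_le_neg_mass[OF i ri(1)])
      fix j assume "j \<in> I" "r j > 0"
      then have "r i * r j \<le> r i * 1" using abs_le[of j] ri by (intro mult_left_mono) auto
      then show "r i * r j < 1" using ri by simp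
    qed
    then show False using less by simp
  qed
qed

lemma ratios_all_one_or_all_minus_one:
  "(\<forall>i\<in>I. r i = 1) \<or> (\<forall>i\<in>I. r i = -1)"
proof (cases "\<exists>k\<in>I. r k > 0")
  case True
  then show ?thesis using all_ratios_one by blast
next
  case False
  interpret neg: stationary_ratios I p "\<lambda>i. - r i"
    by (rule stationary_ratios_uminus)
  show ?thesis
  proof (cases "I = {}")
    case ne: False
    from ex_ratio_nonzero[OF ne] obtain k where k: "k \<in> I" "r k \<noteq> 0" by blast
    then have "- r k > 0" using False by (auto simp: not_less le_less)
    then have "- r i = 1" if "i \<in> I" for i using neg.all_ratios_one k(1) that by blast
    then have "r i = - 1" if "i \<in> I" for i using that by (simp add: minus_equation_iff)
    then show ?thesis by blast
  qed simp
qed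

end

section \<open>Back to the original loss\<close>

lemma rank_one_l1_loss_stationary_support:
  fixes u x :: "real ^ 'n"
  assumes "second_order_stationary (rank_one_l1_loss u) x" and "u $ k = 0"
  shows "x $ k = 0"
proof (rule ccontr)
  assume xk: "x $ k \<noteq> 0"
  define w :: "real ^ 'n" where "w = (\<chi> i. if u $ i = 0 then - x $ i else 0)"
  let ?c = "\<lambda>(i, j). 1/2 * (x $ i * x $ j - u $ i * u $ j)"
  let ?b = "\<lambda>(i, j). 1/2 * (x $ i * w $ j + x $ j * w $ i)"
  let ?a = "\<lambda>(i, j). 1/2 * (w $ i * w $ j)"
  \<comment> \<open>\<open>?e i + ?e j\<close> counts the shrinking factors of a pair. If it is
    nonzero then \<open>u $ i * u $ j = 0\<close>, so the term is
    \<open>\<bar>x $ i * x $ j\<bar> / 2\<close> and shrinks at that rate.\<close>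
  let ?e = "\<lambda>i. if u $ i = 0 then 1 else 0 :: real"
  have D: "dir_abs (?c (i, j)) (?b (i, j)) = - ((?e i + ?e j) * \<bar>?c (i, j)\<bar>)" for i j
  proof -
    have "?b (i, j) = - ((?e i + ?e j) * ?c (i, j))"
      by (auto simp: w_def)
    then show ?thesis
      using dir_abs_neg_multiple[of "?e i + ?e j" "?c (i, j)"] by simp
  qed
  have le: "dir_abs (?c z) (?b z) \<le> 0" for z
    by (cases z) (simp only: D, simp)
  have "(\<Sum>z\<in>UNIV. dir_abs (?c z) (?b z)) < (\<Sum>z\<in>(UNIV :: ('n \<times> 'n) set). 0)"
  proof (rule sum_strict_mono_ex1)
    \<comment> \<open>The pair \<open>(k, k)\<close> has slope \<open>- (x $ k)\<^sup>2\<close>,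
      which makes the sum strictly negative.\<close>
    have "dir_abs (?c (k, k)) (?b (k, k)) < 0"
      using xk assms(2) unfolding D by (auto simp: zero_less_mult_iff)
    then show "\<exists>z\<in>UNIV. dir_abs (?c z) (?b z) < 0" by blast
  qed (use le in auto)
  then have "quadratic_descent (\<lambda>t. \<Sum>z\<in>UNIV. \<bar>?c z + t * ?b z + t\<^sup>2 * ?a z\<bar>)"
    by (intro quadratic_descent_sum_abs) auto
  moreover have "(\<Sum>z\<in>UNIV. \<bar>?c z + t * ?b z + t\<^sup>2 * ?a z\<bar>) = rank_one_l1_loss u (x + t *\<^sub>R w)" for t
  proof -
    have "\<bar>?c (i, j) + t * ?b (i, j) + t\<^sup>2 * ?a (i, j)\<bar>
       = 1/2 * \<bar>(x + t *\<^sub>R w) $ i * (x + t *\<^sub>R w) $ j - u $ i * u $ j\<bar>" for i j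
    proof -
      have "?c (i, j) + t * ?b (i, j) + t\<^sup>2 * ?a (i, j)
          = 1/2 * ((x + t *\<^sub>R w) $ i * (x + t *\<^sub>R w) $ j - u $ i * u $ j)"
        by (simp add: power2_eq_square field_simps)
      then show ?thesis by (simp only: abs_mult)
    qed
    then show ?thesis
      unfolding rank_one_l1_loss_def sum_distrib_left sum.cartesian_product UNIV_Times_UNIV
      by (intro sum.cong refl) (simp only: split_paired_all split)
  qed
  ultimately show False
    using second_order_stationary_no_descent[OF assms(1)] by simp
qed

theorem theorem1:
  fixes u :: "real ^ 'n"
  shows "\<forall>x. second_order_stationary (rank_one_l1_loss u) x \<longrightarrow> global_minimum (rank_one_l1_loss u) x"
proof (intro allI impI)
  fix x assume stat: "second_order_stationary (rank_one_l1_loss u) x"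
  note support = rank_one_l1_loss_stationary_support[OF stat]
  define I where "I = {i. u $ i \<noteq> 0}"
  define p where "p i = \<bar>u $ i\<bar>" for i
  define r where "r i = x $ i / u $ i" for i
  have ratio: "rank_one_l1_loss u (\<chi> i. u $ i * s i) = 1/2 * ratio_loss I p s" for s
  proof -
    have "ratio_loss I p s = (\<Sum>i\<in>UNIV. \<Sum>j\<in>UNIV. p i * p j * \<bar>s i * s j - 1\<bar>)"
      unfolding ratio_loss_def sum.cartesian_product
      by (rule sum.mono_neutral_left) (auto simp: I_def p_def)
    also have "\<dots> = (\<Sum>i\<in>UNIV. \<Sum>j\<in>UNIV. \<bar>u $ i * s i * (u $ j * s j) - u $ i * u $ j\<bar>)"
      by (intro sum.cong refl) (simp add: p_def algebra_simps flip: abs_mult)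
    finally show ?thesis by (simp add: rank_one_l1_loss_def)
  qed
  \<comment> \<open>Where \<open>u $ i = 0\<close> both sides vanish by the support lemma, so the
    ratios determine \<open>x\<close> completely.\<close>
  have x: "x $ i = u $ i * r i" for i
    using support[of i] by (cases "u $ i = 0") (auto simp: r_def)
  interpret stationary_ratios I p r
  proof
    fix v
    have eq: "rank_one_l1_loss u (x + t *\<^sub>R (\<chi> i. u $ i * v i))
        = 1/2 * ratio_loss I p (\<lambda>i. r i + t * v i)" for t
      unfolding ratio[symmetric]
      by (rule arg_cong[where f = "rank_one_l1_loss u"]) (simp add: vec_eq_iff x algebra_simps)
    have "\<not> quadratic_descent (\<lambda>t. 1/2 * ratio_loss I p (\<lambda>i. r i + t * v i))"
      using second_order_stationary_no_descent[OF stat] unfolding eq[symmetric] .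
    moreover have "quadratic_descent (\<lambda>t. 1/2 * \<phi> t)" if "quadratic_descent \<phi>" for \<phi>
    proof -
      from that obtain c where "c > 0" "\<forall>\<^sub>F t in at_right 0. \<phi> t \<le> \<phi> 0 - c * t\<^sup>2"
        unfolding quadratic_descent_def by auto
      then show ?thesis
        unfolding quadratic_descent_def
        by (intro exI[of _ "c / 2"]) (auto elim!: eventually_mono simp: field_simps)
    qed
    ultimately show "\<not> quadratic_descent (\<lambda>t. ratio_loss I p (\<lambda>i. r i + t * v i))"
      by blast
  qed (auto simp: I_def p_def)
  \<comment> \<open>The two alternatives are \<open>x = u\<close> and \<open>x = - u\<close>;
    outside \<open>I\<close> both vectors vanish.\<close>
  have "x $ i * x $ j = u $ i * u $ j" for i j
    using ratios_all_one_or_all_minus_one by (auto simp: x I_def)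
  then have "rank_one_l1_loss u x = 0"
    by (simp add: rank_one_l1_loss_def)
  then show "global_minimum (rank_one_l1_loss u) x"
    by (auto simp: global_minimum_def rank_one_l1_loss_def intro!: sum_nonneg)
qed

end
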